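(* Let $T:\operatorname{dom}(T)\subseteq\mathbb{R}^n\rightrightarrows\mathbb{R}^n$ be a point-to-set mapping and let $C\subseteq\operatorname{dom}(T)$ be a nonempty closed convex set. If $T$ is inner-semicontinuous, then $S_0\subseteq S_*$.
   Context: $\langle\cdot,\cdot\rangle$ is the inner product of $\mathbb{R}^n$; $\operatorname{dom}(T)=\{x\in\mathbb{R}^n: T(x)\neq\emptyset\}$. $T$ is inner-semicontinuous (ISC) at $x\in\operatorname{dom}(T)$ if for every $y\in T(x)$ and every sequence $(x^k)_{k\in\mathbb{N}}\subset\operatorname{dom}(T)$ with $x^k\to x$ there exists a sequence $(y^k)_{k\in\mathbb{N}}$ with $y^k\in T(x^k)$ for all $k$ and $y^k\to y$. $T$ is ISC if it is ISC at every $x\in\operatorname{dom}(T)$. $S_*$ is the solution set of the variational inequality problem: $$S_*=\{x_*\in C:\ \exists\,u_*\in T(x_* )\ \text{with}\ \langle u_*,x-x_*\rangle\ge 0\ \ \forall x\in C\}.$$ $S_0$ is the solution set of the dual problem: $$S_0=\{x_*\in C:\ \langle u,x-x_*\rangle\ge 0\ \ \forall x\in C,\ \forall u\in T(x)\}.$$ *)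

theory Defs
  imports "HOL-Analysis.Analysis"
begin

text \<open>A point-to-set mapping is a total set-valued function; its domain is where the value is nonempty.\<close>

definition dom_set :: "(real ^ 'n \<Rightarrow> (real ^ 'n) set) \<Rightarrow> (real ^ 'n) set" where
  "dom_set T = {x. T x \<noteq> {}}"

definition isc_at :: "(real ^ 'n \<Rightarrow> (real ^ 'n) set) \<Rightarrow> real ^ 'n \<Rightarrow> bool" where
  "isc_at T x \<longleftrightarrow>
     (\<forall>y \<in> T x. \<forall>X :: nat \<Rightarrow> real ^ 'n.
        (\<forall>k. X k \<in> dom_set T) \<and> X \<longlonglongrightarrow> x \<longrightarrow>
        (\<exists>Y. (\<forall>k. Y k \<in> T (X k)) \<and> Y \<longlonglongrightarrow> y))"

definition inner_semicontinuous :: "(real ^ 'n \<Rightarrow> (real ^ 'n) set) \<Rightarrow> bool" where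
  "inner_semicontinuous T \<longleftrightarrow> (\<forall>x \<in> dom_set T. isc_at T x)"

definition VIP_solutions :: "(real ^ 'n \<Rightarrow> (real ^ 'n) set) \<Rightarrow> (real ^ 'n) set \<Rightarrow> (real ^ 'n) set" where
  "VIP_solutions T C = {z \<in> C. \<exists>u \<in> T z. \<forall>x \<in> C. u \<bullet> (x - z) \<ge> 0}"

definition dual_VIP_solutions :: "(real ^ 'n \<Rightarrow> (real ^ 'n) set) \<Rightarrow> (real ^ 'n) set \<Rightarrow> (real ^ 'n) set" where
  "dual_VIP_solutions T C = {z \<in> C. \<forall>x \<in> C. \<forall>u \<in> T x. u \<bullet> (x - z) \<ge> 0}"

end

theory Submission
  imports Defs
begin

text \<open>
  A dual solution \<open>z\<close> is a solution with \<^emph>\<open>every\<close> \<open>u \<in> T z\<close> as witness. Given \<open>x \<in> C\<close>, the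
  dual inequality at a point \<open>z + t (x - z)\<close> of the segment, \<open>0 < t \<le> 1\<close>, can be divided by \<open>t\<close>:
  all values of \<open>T\<close> there have a nonnegative inner product with the fixed vector \<open>x - z\<close>. As
  \<open>t\<close> tends to 0, inner semicontinuity at \<open>z\<close> supplies such values converging to \<open>u\<close>, and the
  inequality passes to the limit (the linearisation argument of Minty's lemma).
\<close>

theorem proposition2p3:
  fixes T :: "real ^ 'n \<Rightarrow> (real ^ 'n) set" and C :: "(real ^ 'n) set"
  assumes "C \<subseteq> dom_set T"
    and "C \<noteq> {}" and "closed C" and "convex C"
    and "inner_semicontinuous T"
  shows "dual_VIP_solutions T C \<subseteq> VIP_solutions T C"
proof
  fix z assume "z \<in> dual_VIP_solutions T C"
  then have zC: "z \<in> C" and dual: "\<And>x u. x \<in> C \<Longrightarrow> u \<in> T x \<Longrightarrow> u \<bullet> (x - z) \<ge> 0"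
    by (auto simp: dual_VIP_solutions_def)
  from zC assms(1) have zD: "z \<in> dom_set T" by blast
  then obtain u where u: "u \<in> T z" by (auto simp: dom_set_def)
  have "u \<bullet> (x - z) \<ge> 0" if xC: "x \<in> C" for x
  proof -
    define t :: "nat \<Rightarrow> real" where "t k = inverse (real (Suc k))" for k
    define X where "X k = z + t k *\<^sub>R (x - z)" for k
    have t: "0 < t k" "t k \<le> 1" for k
      by (auto simp: t_def field_simps)
    have XC: "X k \<in> C" for k
    proof -
      have "X k = (1 - t k) *\<^sub>R z + t k *\<^sub>R x"
        by (simp add: X_def algebra_simps)
      then show ?thesis
        using convexD_alt[OF assms(4) zC xC, of "t k"] t[of k] by simp
    qed
    have "t \<longlonglongrightarrow> 0"
      unfolding t_def by (rule LIMSEQ_inverse_real_of_nat)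
    then have "X \<longlonglongrightarrow> z + 0 *\<^sub>R (x - z)"
      unfolding X_def by (intro tendsto_intros)
    then have "X \<longlonglongrightarrow> z" by simp
    moreover have "\<forall>k. X k \<in> dom_set T" using XC assms(1) by blast
    ultimately obtain Y where Y: "\<And>k. Y k \<in> T (X k)" and lim: "Y \<longlonglongrightarrow> u"
      using assms(5) zD u unfolding inner_semicontinuous_def isc_at_def by blast
    have "Y k \<bullet> (x - z) \<ge> 0" for k
    proof -
      have "0 \<le> t k * (Y k \<bullet> (x - z))"
        using dual[OF XC Y, of k] by (simp add: X_def)
      then show ?thesis using t(1)[of k] by (simp add: zero_le_mult_iff)
    qed
    moreover have "(\<lambda>k. Y k \<bullet> (x - z)) \<longlonglongrightarrow> u \<bullet> (x - z)"
      using lim by (intro tendsto_intros)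
    ultimately show ?thesis
      by (intro LIMSEQ_le_const) auto
  qed
  with zC u show "z \<in> VIP_solutions T C"
    by (auto simp: VIP_solutions_def)
qed

end
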